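(* Consider a sequence of undirected graphs $G=(V,E)$ with $n_v=|V|\to\infty$. For each $G$, let $\{Y_{ij}\}_{\{i,j\}\in V^{(2)}}$ be independent with $Y_{ij}\sim\mathrm{Bernoulli}(\alpha)$ for $\{i,j\}\in E^c$ and $Y_{ij}\sim\mathrm{Bernoulli}(1-\beta)$ for $\{i,j\}\in E$, where $\alpha,\beta\in(0,1)$ may depend on $n_v$. Assume that $\alpha|E^c|=\beta|E|=:\lambda$ and that $\lambda=\Theta(\mu)$, where $\mu=2|E|/n_v$. Let $\hat E=\{\{i,j\}\in V^{(2)}:Y_{ij}=1\}$, $D_E=|\hat E|-|E|$ and $\sigma^2=\mathrm{Var}(D_E)$. Then, as $n_v\to\infty$: for sparse graphs, $$\Omega\left(\log^{-1}n_v\right)\le d_{KS}\left(D_E/\sigma,\,N(0,1)\right)\le O\left(\log^{-1/2}n_v\right),$$ and for dense graphs, $$\Omega\left(n_v^{-1}\right)\le d_{KS}\left(D_E/\sigma,\,N(0,1)\right)\le O\left(n_v^{-1/2}\right).$$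
   Context: $V^{(2)}$ is the set of unordered pairs of distinct vertices of $V$, and $E^c=V^{(2)}\setminus E$. A (sequence of) graph(s) is called sparse if $|E|=\Theta(n_v\log n_v)$, and dense if $|E|=\Theta(n_v^2)$, with $|E^c|=\Theta(n_v^2)$ in both cases. Thus $\lambda=\Theta(\log n_v)$ in the sparse case and $\lambda=\Theta(n_v)$ in the dense case. $N(0,1)$ denotes a standard normal random variable. $d_{KS}(X_1,X_2)=\sup_{x\in\mathbb{R}}|\mathbb{P}(X_1\le x)-\mathbb{P}(X_2\le x)|$. The notation $\Omega(a_{n_v})\le d\le O(b_{n_v})$ means that there are constants $c,C>0$ with $c\,a_{n_v}\le d\le C\,b_{n_v}$ for all sufficiently large $n_v$. *)

theory Defs
  imports
    "HOL-Probability.Probability"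
    "HOL-Library.Ramsey"
    "HOL-Library.Landau_Symbols"
begin

(* A simple undirected graph is a finite vertex set V together with an edge set E \<subseteq> [V]\<^bsup>2\<^esup>. *)

definition non_edges :: "'a set \<Rightarrow> 'a set set \<Rightarrow> 'a set set" where
  "non_edges V E = [V]\<^bsup>2\<^esup> - E"

definition sparse_graphs :: "(nat \<Rightarrow> 'a set) \<Rightarrow> (nat \<Rightarrow> 'a set set) \<Rightarrow> bool" where
  "sparse_graphs V E \<longleftrightarrow>
     (\<lambda>k. real (card (E k))) \<in> \<Theta>(\<lambda>k. real (card (V k)) * ln (real (card (V k)))) \<and>
     (\<lambda>k. real (card (non_edges (V k) (E k)))) \<in> \<Theta>(\<lambda>k. (real (card (V k)))\<^sup>2)"

definition dense_graphs :: "(nat \<Rightarrow> 'a set) \<Rightarrow> (nat \<Rightarrow> 'a set set) \<Rightarrow> bool" where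
  "dense_graphs V E \<longleftrightarrow>
     (\<lambda>k. real (card (E k))) \<in> \<Theta>(\<lambda>k. (real (card (V k)))\<^sup>2) \<and>
     (\<lambda>k. real (card (non_edges (V k) (E k)))) \<in> \<Theta>(\<lambda>k. (real (card (V k)))\<^sup>2)"

(* Y e \<omega> = True encodes the value 1 of the Bernoulli variable attached to the pair e. *)

definition noisy_edges :: "'a set \<Rightarrow> ('a set \<Rightarrow> 'b \<Rightarrow> bool) \<Rightarrow> 'b \<Rightarrow> 'a set set" where
  "noisy_edges V Y \<omega> = {e \<in> [V]\<^bsup>2\<^esup>. Y e \<omega>}"

definition edge_discrepancy ::
    "'a set \<Rightarrow> 'a set set \<Rightarrow> ('a set \<Rightarrow> 'b \<Rightarrow> bool) \<Rightarrow> 'b \<Rightarrow> real" where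
  "edge_discrepancy V E Y \<omega> = real (card (noisy_edges V Y \<omega>)) - real (card E)"

definition std_dev :: "'b measure \<Rightarrow> ('b \<Rightarrow> real) \<Rightarrow> real" where
  "std_dev M X = sqrt (prob_space.variance M X)"

(* Kolmogorov-Smirnov distance between the laws of two real random variables. *)

definition ks_dist :: "real measure \<Rightarrow> real measure \<Rightarrow> real" where
  "ks_dist N1 N2 = (SUP x. \<bar>cdf N1 x - cdf N2 x\<bar>)"

(* \<Omega>(a k) \<le> d k \<le> O(b k) along the sequence. *)

definition asymp_between :: "(nat \<Rightarrow> real) \<Rightarrow> (nat \<Rightarrow> real) \<Rightarrow> (nat \<Rightarrow> real) \<Rightarrow> bool" where
  "asymp_between a d b \<longleftrightarrow>
     (\<exists>c>0. \<exists>C>0. eventually (\<lambda>k. c * a k \<le> d k \<and> d k \<le> C * b k) sequentially)"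

end

theory Submission
  imports Defs
begin

text \<open>
  The number of observed edges is a sum of independent Bernoulli variables whose mean is exactly
  the number of true edges, so the discrepancy is an integer-valued centred sum \<open>D\<close>
  with variance \<open>\<sigma>\<^sup>2 = \<lambda> (2 - \<alpha> - \<beta>)\<close>. Since \<open>\<beta> |E| = \<lambda> = \<Theta>(|E| / n)\<close>,
  the rate \<open>\<beta>\<close> tends to 0 and \<open>\<sigma>\<^sup>2\<close> eventually lies between \<open>\<lambda> / 2\<close> and \<open>2 \<lambda>\<close>. In the sparse and in the dense
  case \<open>\<lambda>\<close> is of order \<open>ln n\<close> and \<open>n\<close>, respectively. The theorem therefore follows from
  \<open>1 / (16 \<sigma>) \<le> d \<le> 9 / \<sigma>\<close> for \<open>\<sigma> \<ge> 1\<close>; the stated lower rate is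
  \<open>1 / \<sigma>\<^sup>2\<close>, which is weaker than \<open>1 / \<sigma>\<close>.

  The lower bound (\<open>lattice_lower_bound\<close>) is a lattice effect: \<open>D\<close> takes no value strictly between
  0 and 1, so its distribution function after scaling is constant on \<open>[0, 1 / (2 \<sigma>)]\<close>,
  where the normal one grows by at least \<open>1 / (8 \<sigma>)\<close>.

  The upper bound (\<open>berry_esseen\<close>) is Stein's method in a form adapted to Bernoulli sums.
  With \<open>W = D / \<sigma>\<close> and \<open>\<delta> = 1 / \<sigma>\<close>, replacing the \<open>i\<close>-th Bernoulli variable by 0 turns \<open>W\<close> into an
  \<open>a\<^sub>i\<close> that is independent of this variable, with \<open>W = a\<^sub>i\<close> or \<open>W = a\<^sub>i + \<delta>\<close>, and
  \<open>E (W f(W))\<close> is the average, weighted by the variances of the summands, of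
  \<open>E (f(a\<^sub>i + \<delta>) - f(a\<^sub>i)) / \<delta>\<close> (\<open>stein_identity\<close>). For \<open>f\<close> take the
  solution of \<open>f'(x) = x f(x) + 1{x \<le> z} - \<Phi>(z)\<close>. The difference quotient is a mean value of \<open>f'\<close> at
  distance at most \<open>\<delta>\<close> from \<open>W\<close>. Moving \<open>x f(x)\<close> to \<open>W f(W)\<close> costs a multiple of
  \<open>(1 + |W|) \<delta>\<close>, as \<open>f\<close> and \<open>f'\<close> are bounded, and moving the indicator
  costs a shift of \<open>z\<close> by \<open>\<delta>\<close> (\<open>stein_sol_step\<close>). The two copies of \<open>E (W f(W))\<close> cancel, and what is left compares
  \<open>P(W \<le> z \<plusminus> \<delta>)\<close> with \<open>\<Phi>(z)\<close> up to an error of \<open>8 \<delta>\<close>.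
\<close>

section \<open>The standard normal distribution function\<close>

abbreviation Phi :: "real \<Rightarrow> real" where
  "Phi \<equiv> cdf std_normal_distribution"

lemma std_normal_density_deriv:
  "(std_normal_density has_real_derivative - x * std_normal_density x) (at x)"
  unfolding std_normal_density_def[abs_def]
  by (auto intro!: derivative_eq_intros simp: field_simps)

lemma Phi_diff_eq_integral:
  assumes "a \<le> b"
  shows "Phi b - Phi a = (LBINT x=a..b. std_normal_density x)"
proof (cases "a = b")
  case False
  then have "a < b" using assms by simp
  interpret N: real_distribution std_normal_distribution by (rule real_dist_normal_dist)
  have int: "set_integrable lborel {a<..b} std_normal_density"
    unfolding set_integrable_def by (intro integrable_mult_indicator) auto
  have "emeasure std_normal_distribution {a<..b}
        = (\<integral>\<^sup>+x\<in>{a<..b}. ennreal (std_normal_density x) \<partial>lborel)"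
    by (subst emeasure_density) auto
  also have "\<dots> = (\<integral>\<^sup>+x. ennreal (indicator {a<..b} x * std_normal_density x) \<partial>lborel)"
    by (intro nn_integral_cong) (auto simp: indicator_def)
  also have "\<dots> = ennreal (LBINT x:{a<..b}. std_normal_density x)"
    using int unfolding set_integrable_def set_lebesgue_integral_def
    by (subst nn_integral_eq_integral) (auto simp: mult.commute)
  finally have "measure std_normal_distribution {a<..b} = (LBINT x:{a<..b}. std_normal_density x)"
    by (simp add: measure_def set_lebesgue_integral_def)
  then show ?thesis
    using N.cdf_diff_eq[OF \<open>a < b\<close>] assms by (simp add: interval_integral_Ioc)
qed auto

lemma Phi_deriv: "(Phi has_real_derivative std_normal_density x) (at x)"
proof -
  define a b where "a = x - 1" and "b = x + 1"
  have cont: "continuous_on {a..b} std_normal_density"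
    by (rule DERIV_continuous_on) (rule has_field_derivative_at_within[OF std_normal_density_deriv])
  have "((\<lambda>u. LBINT y=a..u. std_normal_density y) has_vector_derivative std_normal_density x)
          (at x within {a..b})"
    by (rule interval_integral_FTC2[OF _ _ cont]) (auto simp: a_def b_def)
  then have "((\<lambda>u. LBINT y=a..u. std_normal_density y) has_real_derivative std_normal_density x)
      (at x within {a..b})"
    unfolding has_real_derivative_iff_has_vector_derivative .
  then have shifted: "((\<lambda>u. (LBINT y=a..u. std_normal_density y) + Phi a)
      has_real_derivative std_normal_density x + 0) (at x within {a..b})"
    by (intro DERIV_add DERIV_const)
  have eq: "Phi u = (LBINT y=a..u. std_normal_density y) + Phi a" if "u \<in> {a..b}" for u
    unfolding Phi_diff_eq_integral[symmetric, OF atLeastAtMost_iff[THEN iffD1, THEN conjunct1, OF that]]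
    by (rule diff_add_cancel[symmetric])
  have "(Phi has_real_derivative std_normal_density x + 0) (at x within {a..b})"
    unfolding has_field_derivative_def
    by (rule has_derivative_transform[OF _ eq shifted[unfolded has_field_derivative_def]])
       (simp add: a_def b_def)
  moreover have "at x within {a..b} = at x"
    by (rule at_within_interior) (simp add: a_def b_def)
  ultimately show ?thesis
    by simp
qed

lemma Phi_nonneg: "0 \<le> Phi x" and Phi_le_1: "Phi x \<le> 1" and Phi_mono: "x \<le> y \<Longrightarrow> Phi x \<le> Phi y"
proof -
  interpret N: real_distribution std_normal_distribution by (rule real_dist_normal_dist)
  show "0 \<le> Phi x" "Phi x \<le> 1" "x \<le> y \<Longrightarrow> Phi x \<le> Phi y"
    using N.cdf_nonneg N.cdf_bounded_prob N.cdf_nondecreasing by auto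
qed

lemma Phi_measurable [measurable]: "Phi \<in> borel_measurable borel"
  by (rule borel_measurable_mono) (simp add: mono_def Phi_mono)

lemma Phi_lipschitz:
  assumes "x \<le> y"
  shows "Phi y - Phi x \<le> y - x"
proof (cases "x = y")
  case False
  then obtain t where t: "Phi y - Phi x = (y - x) * std_normal_density t"
    using MVT2[of x y Phi std_normal_density] Phi_deriv assms by force
  have "sqrt (2 * pi) \<ge> 1"
    using pi_gt3 by simp
  then have "(1 / sqrt (2 * pi)) * exp (- t\<^sup>2 / 2) \<le> 1 * 1"
    by (intro mult_mono) (auto simp: divide_simps)
  then have "std_normal_density t \<le> 1"
    by (simp add: std_normal_density_def)
  then show ?thesis
    using t assms by (simp add: mult_left_le)
qed simp

text \<open>Mills' ratio bound: on \<open>[x, \<infinity>)\<close> the function \<open>x \<Phi> + \<phi>\<close> has derivative \<open>(x - t) \<phi>(t) \<le> 0\<close>;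
  compare its value at \<open>x\<close> with its limit.\<close>

lemma Mills_upper:
  assumes "0 < x"
  shows "x * (1 - Phi x) \<le> std_normal_density x"
proof -
  interpret N: real_distribution std_normal_distribution by (rule real_dist_normal_dist)
  have le: "x * Phi T \<le> x * Phi x + std_normal_density x" if "x \<le> T" for T
  proof -
    have "x * Phi T + std_normal_density T \<le> x * Phi x + std_normal_density x"
    proof (rule DERIV_nonpos_imp_nonincreasing[OF that])
      fix t assume "x \<le> t" "t \<le> T"
      then show "\<exists>y. ((\<lambda>t. x * Phi t + std_normal_density t) has_real_derivative y) (at t) \<and> y \<le> 0"
        by (intro exI[of _ "(x - t) * std_normal_density t"] conjI)
           (auto intro!: derivative_eq_intros Phi_deriv std_normal_density_deriv
                 simp: algebra_simps mult_right_mono)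
    qed
    then show ?thesis using normal_density_nonneg[of 0 1 T] by linarith
  qed
  have "((\<lambda>T. x * Phi T) \<longlongrightarrow> x * 1) at_top"
    by (intro tendsto_intros N.cdf_lim_at_top_prob)
  then have "x * 1 \<le> x * Phi x + std_normal_density x"
    by (rule tendsto_upperbound) (use le in \<open>auto simp: eventually_at_top_linorder\<close>)
  then show ?thesis by (simp add: algebra_simps)
qed

text \<open>The mirror image of the previous bound, by the same monotonicity argument towards \<open>-\<infinity>\<close>.\<close>

lemma Mills_lower:
  assumes "x < 0"
  shows "- x * Phi x \<le> std_normal_density x"
proof -
  interpret N: real_distribution std_normal_distribution by (rule real_dist_normal_dist)
  have le: "- x * Phi x - std_normal_density x \<le> - x * Phi T" if "T \<le> x" for T
  proof -
    have "- x * Phi x - std_normal_density x \<le> - x * Phi T - std_normal_density T"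
    proof (rule DERIV_nonpos_imp_nonincreasing[OF that])
      fix t assume "T \<le> t" "t \<le> x"
      then show "\<exists>y. ((\<lambda>t. - x * Phi t - std_normal_density t) has_real_derivative y) (at t) \<and> y \<le> 0"
        by (intro exI[of _ "(t - x) * std_normal_density t"] conjI)
           (auto intro!: derivative_eq_intros Phi_deriv std_normal_density_deriv mult_nonpos_nonneg
                 simp: algebra_simps mult_right_mono)
    qed
    then show ?thesis using normal_density_nonneg[of 0 1 T] by linarith
  qed
  have "((\<lambda>T. - x * Phi T) \<longlongrightarrow> - x * 0) at_bot"
    by (intro tendsto_intros N.cdf_lim_at_bot)
  then have "- x * Phi x - std_normal_density x \<le> - x * 0"
    by (rule tendsto_lowerbound) (use le in \<open>auto simp: eventually_at_bot_linorder\<close>)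
  then show ?thesis by simp
qed

section \<open>Stein's equation for a half-line\<close>

text \<open>The bounded solution of \<open>f'(w) = w f(w) + 1{w \<le> z} - \<Phi>(z)\<close> for \<open>w \<noteq> z\<close>. It is usually written in
  two cases, \<open>w \<le> z\<close> and \<open>w > z\<close>; minimum and maximum merge them and make the sign, the
  measurability and the tail estimates uniform in \<open>w\<close>.\<close>

definition stein_sol :: "real \<Rightarrow> real \<Rightarrow> real" where
  "stein_sol z w = Phi (min w z) * (1 - Phi (max w z)) / std_normal_density w"

lemma stein_sol_measurable [measurable]: "stein_sol z \<in> borel_measurable borel"
  unfolding stein_sol_def[abs_def] by measurable

lemma std_normal_density_pos: "0 < std_normal_density x"
  by (simp add: normal_density_pos)

lemma stein_sol_nonneg: "0 \<le> stein_sol z w"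
  unfolding stein_sol_def using Phi_nonneg Phi_le_1 by auto

text \<open>One of the two factors in the numerator is dominated by the tail of the normal law on the side of
  \<open>w\<close>, so this is Mills' ratio bound.\<close>

lemma stein_sol_times_le_1: "\<bar>w * stein_sol z w\<bar> \<le> 1"
proof (cases w "0::real" rule: linorder_cases)
  case less
  have "Phi (min w z) * (1 - Phi (max w z)) \<le> Phi w * 1"
    by (intro mult_mono) (auto intro: Phi_mono simp: Phi_nonneg Phi_le_1)
  then have "- w * (Phi (min w z) * (1 - Phi (max w z))) \<le> - w * Phi w"
    using less by (intro mult_left_mono) auto
  then have "- w * (Phi (min w z) * (1 - Phi (max w z))) \<le> std_normal_density w"
    using Mills_lower[OF less] by linarith
  then show ?thesis
    using less stein_sol_nonneg[of z w] std_normal_density_pos[of w]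
    by (simp add: abs_mult) (simp add: stein_sol_def divide_simps)
next
  case greater
  have "Phi (min w z) * (1 - Phi (max w z)) \<le> 1 * (1 - Phi w)"
    by (intro mult_mono) (auto intro: Phi_mono simp: Phi_nonneg Phi_le_1)
  then have "w * (Phi (min w z) * (1 - Phi (max w z))) \<le> w * (1 - Phi w)"
    using greater by (intro mult_left_mono) auto
  then have "w * (Phi (min w z) * (1 - Phi (max w z))) \<le> std_normal_density w"
    using Mills_upper[OF greater] by linarith
  then show ?thesis
    using greater stein_sol_nonneg[of z w] std_normal_density_pos[of w]
    by (simp add: abs_mult) (simp add: stein_sol_def divide_simps)
qed auto

text \<open>Away from \<open>[-1, 1]\<close> this follows from the bound on \<open>w f(w)\<close>; inside, the numerator is at most 1
  and \<open>1 / \<phi> \<le> \<surd>(2 \<pi>) e\<^sup>1\<^sup>/\<^sup>2 \<le> 3 \<sqdot> 2\<close>.\<close>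

lemma stein_sol_le: "stein_sol z w \<le> 6"
proof (cases "\<bar>w\<bar> \<le> 1")
  case True
  have "Phi (min w z) * (1 - Phi (max w z)) \<le> 1 * 1"
    by (intro mult_mono) (auto simp: Phi_nonneg Phi_le_1)
  then have "stein_sol z w \<le> 1 / std_normal_density w"
    using std_normal_density_pos[of w] by (simp add: stein_sol_def divide_simps)
  also have "\<dots> = sqrt (2 * pi) * exp (w\<^sup>2 / 2)"
    by (simp add: std_normal_density_def exp_minus field_simps)
  also have "\<dots> \<le> 3 * 2"
  proof (intro mult_mono)
    show "sqrt (2 * pi) \<le> 3"
      using pi_less_4 by (intro real_le_lsqrt) auto
    have "exp (w\<^sup>2 / 2) \<le> exp (1 / 2)"
      using True by (simp add: abs_square_le_1)
    then show "exp (w\<^sup>2 / 2) \<le> 2"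
      using exp_half_le2 by linarith
  qed auto
  finally show ?thesis by simp
next
  case False
  have "\<bar>w\<bar> * stein_sol z w \<le> 1"
    using stein_sol_times_le_1[of w z] stein_sol_nonneg[of z w] by (simp add: abs_mult)
  moreover have "1 * stein_sol z w \<le> \<bar>w\<bar> * stein_sol z w"
    using False stein_sol_nonneg[of z w] by (intro mult_right_mono) auto
  ultimately show ?thesis by linarith
qed

text \<open>The right-hand side of Stein's equation. At the kink \<open>x = z\<close> the solution has no derivative, so
  only mean values of this function are used, never a derivative of \<open>stein_sol\<close>.\<close>

definition stein_slope :: "real \<Rightarrow> real \<Rightarrow> real" where
  "stein_slope z x = x * stein_sol z x + of_bool (x \<le> z) - Phi z"

text \<open>An interval that does not have \<open>z\<close> in its interior sees only one of the two smooth branches of the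
  solution, and each branch extends to a differentiable function on the whole line.\<close>

lemma stein_sol_mvt:
  assumes "a < b" "b \<le> z \<or> z \<le> a"
  shows "\<exists>x. a < x \<and> x < b \<and> stein_sol z b - stein_sol z a = (b - a) * stein_slope z x"
  using assms(2)
proof
  assume "b \<le> z"
  define A where "A = (\<lambda>x. Phi x * (1 - Phi z) / std_normal_density x)"
  have eq: "stein_sol z x = A x" if "x \<le> b" for x
    using that \<open>b \<le> z\<close> by (simp add: stein_sol_def A_def min_def max_def)
  have "(A has_real_derivative x * A x + 1 - Phi z) (at x)" for x
    unfolding A_def using std_normal_density_pos[of x]
    by (auto intro!: derivative_eq_intros Phi_deriv std_normal_density_deriv simp: field_simps power2_eq_square)
  then obtain x where "a < x" "x < b" "A b - A a = (b - a) * (x * A x + 1 - Phi z)"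
    using MVT2[OF \<open>a < b\<close>, of A "\<lambda>x. x * A x + 1 - Phi z"] by auto
  then show ?thesis
    using assms(1) \<open>b \<le> z\<close> by (intro exI[of _ x]) (simp add: eq stein_slope_def)
next
  assume "z \<le> a"
  define B where "B = (\<lambda>x. Phi z * (1 - Phi x) / std_normal_density x)"
  have eq: "stein_sol z x = B x" if "a \<le> x" for x
    using that \<open>z \<le> a\<close> by (cases "x = z") (auto simp: stein_sol_def B_def min_def max_def)
  have "(B has_real_derivative x * B x - Phi z) (at x)" for x
    unfolding B_def using std_normal_density_pos[of x]
    by (auto intro!: derivative_eq_intros Phi_deriv std_normal_density_deriv simp: field_simps power2_eq_square)
  then obtain x where "a < x" "x < b" "B b - B a = (b - a) * (x * B x - Phi z)"
    using MVT2[OF \<open>a < b\<close>, of B "\<lambda>x. x * B x - Phi z"] by auto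
  then show ?thesis
    using assms(1) \<open>z \<le> a\<close> by (intro exI[of _ x]) (simp add: eq stein_slope_def)
qed

text \<open>Bounds on the slope integrate to bounds on the increment even across the kink, because the two
  pieces on either side of \<open>z\<close> add up.\<close>

lemma stein_sol_increment:
  assumes "a \<le> b" and slope: "\<And>x. a < x \<Longrightarrow> x < b \<Longrightarrow> L \<le> stein_slope z x \<and> stein_slope z x \<le> U"
  shows "(b - a) * L \<le> stein_sol z b - stein_sol z a \<and> stein_sol z b - stein_sol z a \<le> (b - a) * U"
proof -
  have piece: "(d - c) * L \<le> stein_sol z d - stein_sol z c \<and> stein_sol z d - stein_sol z c \<le> (d - c) * U"
    if "a \<le> c" "c \<le> d" "d \<le> b" "d \<le> z \<or> z \<le> c" for c d
  proof (cases "c = d")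
    case False
    then obtain x where "c < x" "x < d" "stein_sol z d - stein_sol z c = (d - c) * stein_slope z x"
      using stein_sol_mvt[of c d z] \<open>c \<le> d\<close> \<open>d \<le> z \<or> z \<le> c\<close> by auto
    then show ?thesis
      using slope[of x] that by (auto intro: mult_left_mono)
  qed simp
  show ?thesis
  proof (cases "a < z \<and> z < b")
    case True
    then show ?thesis
      using piece[of a z] piece[of z b] by (simp add: algebra_simps)
  next
    case False
    then show ?thesis using piece[of a b] assms(1) by auto
  qed
qed

text \<open>In \<open>x f(x) + 1{x \<le> z} - \<Phi>(z)\<close> the first part is at most 1 in absolute value, and so is the rest.\<close>

lemma stein_sol_lipschitz: "\<bar>stein_sol z x - stein_sol z y\<bar> \<le> 2 * \<bar>x - y\<bar>"
proof -
  have slope: "- 2 \<le> stein_slope z t \<and> stein_slope z t \<le> 2" for t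
    using stein_sol_times_le_1[of t z] Phi_nonneg[of z] Phi_le_1[of z]
    unfolding stein_slope_def by (auto simp: of_bool_def)
  have "\<bar>stein_sol z b - stein_sol z a\<bar> \<le> 2 * (b - a)" if "a \<le> b" for a b
    using stein_sol_increment[OF that slope] by (auto simp: algebra_simps abs_le_iff)
  from this[of x y] this[of y x] show ?thesis by (cases "x \<le> y") auto
qed

lemma times_stein_sol_close:
  "\<bar>x * stein_sol z x - w * stein_sol z w\<bar> \<le> (6 + 2 * \<bar>w\<bar>) * \<bar>x - w\<bar>"
proof -
  have "x * stein_sol z x - w * stein_sol z w
      = (x - w) * stein_sol z x + w * (stein_sol z x - stein_sol z w)"
    by (simp add: algebra_simps)
  also have "\<bar>\<dots>\<bar> \<le> \<bar>x - w\<bar> * 6 + \<bar>w\<bar> * (2 * \<bar>x - w\<bar>)"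
    using stein_sol_le[of z x] stein_sol_nonneg[of z x] stein_sol_lipschitz[of z x w]
    by (intro order.trans[OF abs_triangle_ineq] add_mono) (auto simp: abs_mult intro: mult_left_mono)
  finally show ?thesis by (simp add: algebra_simps)
qed

text \<open>What the Bernoulli identity consumes: the increment over a step of length \<open>\<delta>\<close>, expressed at
  either endpoint \<open>w\<close>. Since every point of the step is within \<open>\<delta>\<close> of \<open>w\<close>, the indicator of
  \<open>x \<le> z\<close> is squeezed between those of \<open>w \<le> z - \<delta>\<close> and \<open>w \<le> z + \<delta>\<close>.\<close>

lemma stein_sol_step:
  assumes "0 \<le> \<delta>" and w: "w = a \<or> w = a + \<delta>"
  defines "err \<equiv> (6 + 2 * \<bar>w\<bar>) * \<delta>"
  shows "stein_sol z (a + \<delta>) - stein_sol z a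
           \<le> \<delta> * (w * stein_sol z w + of_bool (w \<le> z + \<delta>) - Phi z + err)"
    and "\<delta> * (w * stein_sol z w + of_bool (w \<le> z - \<delta>) - Phi z - err)
           \<le> stein_sol z (a + \<delta>) - stein_sol z a"
proof -
  have "w * stein_sol z w + of_bool (w \<le> z - \<delta>) - Phi z - err \<le> stein_slope z x \<and>
        stein_slope z x \<le> w * stein_sol z w + of_bool (w \<le> z + \<delta>) - Phi z + err"
    if "a < x" "x < a + \<delta>" for x
  proof -
    have "\<bar>x - w\<bar> \<le> \<delta>" using that w by auto
    then have "(6 + 2 * \<bar>w\<bar>) * \<bar>x - w\<bar> \<le> err"
      unfolding err_def by (intro mult_left_mono) auto
    then have "\<bar>x * stein_sol z x - w * stein_sol z w\<bar> \<le> err"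
      using times_stein_sol_close order.trans by blast
    then show ?thesis
      using that w unfolding stein_slope_def of_bool_def by auto
  qed
  from stein_sol_increment[of a "a + \<delta>", OF _ this] assms(1)
  show "stein_sol z (a + \<delta>) - stein_sol z a
           \<le> \<delta> * (w * stein_sol z w + of_bool (w \<le> z + \<delta>) - Phi z + err)"
    and "\<delta> * (w * stein_sol z w + of_bool (w \<le> z - \<delta>) - Phi z - err)
           \<le> stein_sol z (a + \<delta>) - stein_sol z a"
    by auto
qed

section \<open>Normal approximation of a sum of independent Bernoulli variables\<close>

locale bernoulli_sum = prob_space M for M :: "'b measure" +
  fixes I :: "'i set" and Y :: "'i \<Rightarrow> 'b \<Rightarrow> bool" and p :: "'i \<Rightarrow> real"
  assumes finite_I: "finite I"
    and indep: "indep_vars (\<lambda>_. count_space UNIV) Y I"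
    and prob_Y: "i \<in> I \<Longrightarrow> prob {\<omega> \<in> space M. Y i \<omega>} = p i"
begin

definition successes :: "'i set \<Rightarrow> 'b \<Rightarrow> real" where
  "successes J \<omega> = (\<Sum>i\<in>J. of_bool (Y i \<omega>))"

definition mean :: real where
  "mean = (\<Sum>i\<in>I. p i)"

definition bernoulli_var :: "'i \<Rightarrow> real" where
  "bernoulli_var i = p i * (1 - p i)"

lemma of_bool_Y_measurable [measurable]:
  assumes "i \<in> I"
  shows "(\<lambda>\<omega>. of_bool (Y i \<omega>) :: real) \<in> borel_measurable M"
proof -
  have "Y i \<in> measurable M (count_space UNIV)"
    using indep assms unfolding indep_vars_def2 by auto
  then show ?thesis
    by (rule measurable_compose) simp
qed

lemma successes_measurable [measurable]:
  "J \<subseteq> I \<Longrightarrow> successes J \<in> borel_measurable M"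
  unfolding successes_def[abs_def] by (intro borel_measurable_sum) auto

lemma successes_eq_card:
  assumes "J \<subseteq> I"
  shows "successes J \<omega> = real (card {i \<in> J. Y i \<omega>})"
  using finite_subset[OF assms finite_I] by (simp add: successes_def of_bool_def sum.If_cases Int_def)

text \<open>Only finitely many values occur, so boundedness of \<open>g\<close> is automatic.\<close>

lemma integrable_successes:
  fixes g :: "real \<Rightarrow> real"
  assumes J: "J \<subseteq> I" and g [measurable]: "g \<in> borel_measurable borel"
  shows "integrable M (\<lambda>\<omega>. g (successes J \<omega>))"
proof (rule integrable_const_bound)
  show "AE \<omega> in M. norm (g (successes J \<omega>)) \<le> (\<Sum>n\<le>card J. \<bar>g (real n)\<bar>)"
  proof (rule AE_I2)
    fix \<omega>
    have "card {i \<in> J. Y i \<omega>} \<le> card J"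
      using finite_subset[OF J finite_I] by (intro card_mono) auto
    then have "\<bar>g (real (card {i \<in> J. Y i \<omega>}))\<bar> \<le> (\<Sum>n\<le>card J. \<bar>g (real n)\<bar>)"
      by (intro member_le_sum[where f = "\<lambda>n. \<bar>g (real n)\<bar>"]) auto
    then show "norm (g (successes J \<omega>)) \<le> (\<Sum>n\<le>card J. \<bar>g (real n)\<bar>)"
      using successes_eq_card[OF J] by simp
  qed
qed (use J in measurable)

lemma expectation_of_bool_Y: "i \<in> I \<Longrightarrow> expectation (\<lambda>\<omega>. of_bool (Y i \<omega>)) = p i"
proof -
  assume i: "i \<in> I"
  have "Y i \<in> measurable M (count_space UNIV)"
    using indep i unfolding indep_vars_def2 by auto
  then have ev: "{\<omega> \<in> space M. Y i \<omega>} \<in> events"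
    by measurable
  have "expectation (\<lambda>\<omega>. of_bool (Y i \<omega>)) = expectation (indicator {\<omega> \<in> space M. Y i \<omega>})"
    by (intro Bochner_Integration.integral_cong) (auto simp: indicator_def)
  also have "\<dots> = p i"
    using prob_Y[OF i] ev by (simp add: Int_absorb2)
  finally show ?thesis .
qed

lemma expectation_times_others:
  fixes g :: "real \<Rightarrow> real"
  assumes i: "i \<in> I" and g [measurable]: "g \<in> borel_measurable borel"
  shows "expectation (\<lambda>\<omega>. of_bool (Y i \<omega>) * g (successes (I - {i}) \<omega>))
           = p i * expectation (\<lambda>\<omega>. g (successes (I - {i}) \<omega>))"
    and "integrable M (\<lambda>\<omega>. of_bool (Y i \<omega>) * g (successes (I - {i}) \<omega>))"
proof -
  have "indep_vars (\<lambda>_. borel) (\<lambda>i \<omega>. of_bool (Y i \<omega>) :: real) I"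
    by (rule indep_vars_compose2[OF indep]) simp
  then have "indep_var borel (\<lambda>\<omega>. of_bool (Y i \<omega>)) borel (successes (I - {i}))"
    unfolding successes_def[abs_def]
    using finite_I i by (intro indep_vars_sum) (auto simp: insert_absorb)
  then have ind: "indep_var borel (\<lambda>\<omega>. of_bool (Y i \<omega>) :: real) borel (\<lambda>\<omega>. g (successes (I - {i}) \<omega>))"
    using indep_var_compose[of borel _ borel _ "\<lambda>x. x" borel g borel] g by (simp add: comp_def)
  have int: "integrable M (\<lambda>\<omega>. of_bool (Y i \<omega>) :: real)"
    using i by (intro integrable_const_bound[where B = 1]) auto
  have int': "integrable M (\<lambda>\<omega>. g (successes (I - {i}) \<omega>))"
    by (rule integrable_successes) auto
  show "expectation (\<lambda>\<omega>. of_bool (Y i \<omega>) * g (successes (I - {i}) \<omega>))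
           = p i * expectation (\<lambda>\<omega>. g (successes (I - {i}) \<omega>))"
    using indep_var_lebesgue_integral[OF ind int int'] expectation_of_bool_Y[OF i] by simp
  show "integrable M (\<lambda>\<omega>. of_bool (Y i \<omega>) * g (successes (I - {i}) \<omega>))"
    by (rule indep_var_integrable[OF ind int int'])
qed

lemma successes_split:
  "i \<in> I \<Longrightarrow> successes I \<omega> = of_bool (Y i \<omega>) + successes (I - {i}) \<omega>"
  unfolding successes_def using finite_I by (rule sum.remove)

text \<open>The Bernoulli form of integration by parts. Condition on the other summands, with sum \<open>R\<close>: the
  value \<open>g(R + 1)\<close> appears with weight \<open>p (1 - p)\<close> and \<open>g(R)\<close> with weight \<open>-(1 - p) p\<close>.\<close>

lemma centered_term:
  fixes g :: "real \<Rightarrow> real"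
  assumes i: "i \<in> I" and g [measurable]: "g \<in> borel_measurable borel"
  defines "R \<equiv> successes (I - {i})"
  shows "has_bochner_integral M (\<lambda>\<omega>. (of_bool (Y i \<omega>) - p i) * g (successes I \<omega>))
           (bernoulli_var i * expectation (\<lambda>\<omega>. g (R \<omega> + 1) - g (R \<omega>)))"
proof -
  have g1 [measurable]: "(\<lambda>x. g (x + 1)) \<in> borel_measurable borel"
    by measurable
  note times = expectation_times_others[OF i, folded R_def]
  have int: "integrable M (\<lambda>\<omega>. g (R \<omega> + 1))" "integrable M (\<lambda>\<omega>. g (R \<omega>))"
    unfolding R_def by (auto intro!: integrable_successes[where g = "\<lambda>x. g (x + 1)"] integrable_successes)
  have eq: "(of_bool (Y i \<omega>) - p i) * g (successes I \<omega>)
      = (1 - p i) * (of_bool (Y i \<omega>) * g (R \<omega> + 1)) - p i * g (R \<omega>) + p i * (of_bool (Y i \<omega>) * g (R \<omega>))"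
    for \<omega>
    using successes_split[OF i, of \<omega>] by (cases "Y i \<omega>") (auto simp: R_def algebra_simps)
  have "has_bochner_integral M (\<lambda>\<omega>. (1 - p i) * (of_bool (Y i \<omega>) * g (R \<omega> + 1)) - p i * g (R \<omega>)
        + p i * (of_bool (Y i \<omega>) * g (R \<omega>)))
      ((1 - p i) * (p i * expectation (\<lambda>\<omega>. g (R \<omega> + 1))) - p i * expectation (\<lambda>\<omega>. g (R \<omega>))
        + p i * (p i * expectation (\<lambda>\<omega>. g (R \<omega>))))"
    using times[OF g] times[OF g1] int
    by (intro has_bochner_integral_add has_bochner_integral_diff has_bochner_integral_mult_right)
       (auto simp: has_bochner_integral_iff)
  moreover have "(1 - p i) * (p i * expectation (\<lambda>\<omega>. g (R \<omega> + 1))) - p i * expectation (\<lambda>\<omega>. g (R \<omega>))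
        + p i * (p i * expectation (\<lambda>\<omega>. g (R \<omega>)))
      = bernoulli_var i * expectation (\<lambda>\<omega>. g (R \<omega> + 1) - g (R \<omega>))"
    unfolding Bochner_Integration.integral_diff[OF int] by (simp add: bernoulli_var_def algebra_simps)
  ultimately show ?thesis
    unfolding eq by simp
qed

text \<open>The discrete counterpart of \<open>E (Z g(Z)) = \<sigma>\<^sup>2 E g'(Z)\<close> for a centred normal \<open>Z\<close>. Constant and
  linear \<open>g\<close> give the mean and the variance.\<close>

lemma stein_identity:
  fixes g :: "real \<Rightarrow> real"
  assumes g [measurable]: "g \<in> borel_measurable borel"
  shows "expectation (\<lambda>\<omega>. (successes I \<omega> - mean) * g (successes I \<omega>))
    = (\<Sum>i\<in>I. bernoulli_var i * expectation (\<lambda>\<omega>. g (successes (I - {i}) \<omega> + 1) - g (successes (I - {i}) \<omega>)))"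
proof -
  have "(successes I \<omega> - mean) * g (successes I \<omega>)
      = (\<Sum>i\<in>I. (of_bool (Y i \<omega>) - p i) * g (successes I \<omega>))" for \<omega>
    by (simp add: sum_distrib_right[symmetric] sum_subtractf mean_def successes_def)
  moreover have "has_bochner_integral M (\<lambda>\<omega>. \<Sum>i\<in>I. (of_bool (Y i \<omega>) - p i) * g (successes I \<omega>))
    (\<Sum>i\<in>I. bernoulli_var i * expectation (\<lambda>\<omega>. g (successes (I - {i}) \<omega> + 1) - g (successes (I - {i}) \<omega>)))"
    by (intro has_bochner_integral_sum centered_term g)
  ultimately show ?thesis
    by (simp add: has_bochner_integral_iff)
qed

lemma expectation_successes: "expectation (successes I) = mean"
proof -
  have "expectation (\<lambda>\<omega>. successes I \<omega> - mean) = 0"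
    using stein_identity[of "\<lambda>_. 1"] by simp
  moreover have "integrable M (successes I)"
    using integrable_successes[of I "\<lambda>x. x"] by simp
  ultimately show ?thesis
    by (simp add: prob_space)
qed

lemma expectation_square: "expectation (\<lambda>\<omega>. (successes I \<omega> - mean)\<^sup>2) = (\<Sum>i\<in>I. bernoulli_var i)"
  using stein_identity[of "\<lambda>x. x - mean"] by (simp add: power2_eq_square prob_space)

lemma p_bounds: "i \<in> I \<Longrightarrow> 0 \<le> p i \<and> p i \<le> 1"
  using prob_Y[of i] by (metis measure_nonneg prob_le_1)

lemma bernoulli_var_nonneg: "i \<in> I \<Longrightarrow> 0 \<le> bernoulli_var i"
  using p_bounds[of i] by (simp add: bernoulli_var_def)

definition normalized :: "real \<Rightarrow> 'b \<Rightarrow> real" where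
  "normalized s \<omega> = (successes I \<omega> - mean) / s"

lemma normalized_measurable [measurable]: "normalized s \<in> borel_measurable M"
  unfolding normalized_def[abs_def] by measurable

lemma integrable_normalized:
  fixes g :: "real \<Rightarrow> real"
  assumes g [measurable]: "g \<in> borel_measurable borel"
  shows "integrable M (\<lambda>\<omega>. g (normalized s \<omega>))"
  unfolding normalized_def by (rule integrable_successes[where g = "\<lambda>x. g ((x - mean) / s)"]) auto

context
  fixes s :: real
  assumes s_pos: "0 < s" and s_sq: "s\<^sup>2 = (\<Sum>i\<in>I. bernoulli_var i)"
begin

text \<open>From \<open>E W\<^sup>2 = 1\<close> and \<open>2 |W| \<le> W\<^sup>2 + 1\<close>.\<close>

lemma expectation_abs_normalized: "expectation (\<lambda>\<omega>. \<bar>normalized s \<omega>\<bar>) \<le> 1"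
proof -
  have "expectation (\<lambda>\<omega>. (normalized s \<omega>)\<^sup>2) = expectation (\<lambda>\<omega>. (successes I \<omega> - mean)\<^sup>2) / s\<^sup>2"
    by (simp add: normalized_def power_divide)
  also have "\<dots> = 1"
    using s_pos by (simp add: expectation_square s_sq[symmetric])
  finally have sq: "expectation (\<lambda>\<omega>. (normalized s \<omega>)\<^sup>2) = 1" .
  have "\<bar>x\<bar> \<le> (x\<^sup>2 + 1) / 2" for x :: real
    using zero_le_power2[of "\<bar>x\<bar> - 1"] by (simp add: power2_eq_square algebra_simps)
  then have "expectation (\<lambda>\<omega>. \<bar>normalized s \<omega>\<bar>) \<le> expectation (\<lambda>\<omega>. ((normalized s \<omega>)\<^sup>2 + 1) / 2)"
    by (intro integral_mono integrable_normalized[where g = "\<lambda>x. \<bar>x\<bar>"]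
              integrable_normalized[where g = "\<lambda>x. (x\<^sup>2 + 1) / 2"]) auto
  also have "\<dots> = 1"
    using integrable_normalized[of "\<lambda>x. x\<^sup>2"] by (simp add: sq prob_space)
  finally show ?thesis .
qed

text \<open>The summation over \<open>i\<close> is eliminated here: a bound on every increment that depends on the
  summand only through the value \<open>w\<close> of the whole normalized sum can be pulled out of the weighted average, and the
  weights \<open>p\<^sub>i (1 - p\<^sub>i) / s\<^sup>2\<close> add up to 1.\<close>

lemma stein_comparison:
  fixes f h :: "real \<Rightarrow> real"
  assumes f [measurable]: "f \<in> borel_measurable borel"
    and h [measurable]: "h \<in> borel_measurable borel"
    and step: "\<And>a w. w = a \<or> w = a + 1 / s \<Longrightarrow> f (a + 1 / s) - f a \<le> 1 / s * h w"
  shows "expectation (\<lambda>\<omega>. normalized s \<omega> * f (normalized s \<omega>)) \<le> expectation (\<lambda>\<omega>. h (normalized s \<omega>))"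
proof -
  define g where "g x = f ((x - mean) / s)" for x
  have g [measurable]: "g \<in> borel_measurable borel" unfolding g_def[abs_def] by measurable
  have term_le: "expectation (\<lambda>\<omega>. g (successes (I - {i}) \<omega> + 1) - g (successes (I - {i}) \<omega>))
      \<le> 1 / s * expectation (\<lambda>\<omega>. h (normalized s \<omega>))" if i: "i \<in> I" for i
  proof -
    have "expectation (\<lambda>\<omega>. g (successes (I - {i}) \<omega> + 1) - g (successes (I - {i}) \<omega>))
        \<le> expectation (\<lambda>\<omega>. 1 / s * h (normalized s \<omega>))"
    proof (rule integral_mono)
      show "integrable M (\<lambda>\<omega>. g (successes (I - {i}) \<omega> + 1) - g (successes (I - {i}) \<omega>))"
        by (rule integrable_successes[where g = "\<lambda>x. g (x + 1) - g x"]) auto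
      show "integrable M (\<lambda>\<omega>. 1 / s * h (normalized s \<omega>))"
        by (intro integrable_mult_right integrable_normalized h)
      fix \<omega>
      define a where "a = (successes (I - {i}) \<omega> - mean) / s"
      have "g (successes (I - {i}) \<omega> + 1) = f (a + 1 / s)" "g (successes (I - {i}) \<omega>) = f a"
        by (simp_all add: g_def a_def diff_divide_distrib add_divide_distrib algebra_simps)
      moreover have "normalized s \<omega> = a \<or> normalized s \<omega> = a + 1 / s"
        using successes_split[OF i, of \<omega>]
        by (cases "Y i \<omega>") (simp_all add: normalized_def a_def diff_divide_distrib add_divide_distrib)
      ultimately show "g (successes (I - {i}) \<omega> + 1) - g (successes (I - {i}) \<omega>) \<le> 1 / s * h (normalized s \<omega>)"
        using step by simp
    qed
    then show ?thesis by simp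
  qed
  have "s * expectation (\<lambda>\<omega>. normalized s \<omega> * f (normalized s \<omega>))
      = expectation (\<lambda>\<omega>. (successes I \<omega> - mean) * g (successes I \<omega>))"
    unfolding integral_mult_right_zero[symmetric]
    using s_pos by (intro Bochner_Integration.integral_cong) (auto simp: normalized_def g_def)
  also have "\<dots> = (\<Sum>i\<in>I. bernoulli_var i * expectation (\<lambda>\<omega>. g (successes (I - {i}) \<omega> + 1) - g (successes (I - {i}) \<omega>)))"
    by (rule stein_identity) measurable
  also have "\<dots> \<le> (\<Sum>i\<in>I. bernoulli_var i * (1 / s * expectation (\<lambda>\<omega>. h (normalized s \<omega>))))"
    by (intro sum_mono mult_left_mono term_le bernoulli_var_nonneg)
  also have "\<dots> = s\<^sup>2 * (1 / s * expectation (\<lambda>\<omega>. h (normalized s \<omega>)))"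
    unfolding s_sq sum_distrib_right ..
  also have "\<dots> = s * expectation (\<lambda>\<omega>. h (normalized s \<omega>))"
    using s_pos by (simp add: power2_eq_square)
  finally show ?thesis
    using s_pos by simp
qed

lemma stein_error_le: "expectation (\<lambda>\<omega>. (6 + 2 * \<bar>normalized s \<omega>\<bar>) * (1 / s)) \<le> 8 / s"
proof -
  have "expectation (\<lambda>\<omega>. (6 + 2 * \<bar>normalized s \<omega>\<bar>) * (1 / s)) = (6 + 2 * expectation (\<lambda>\<omega>. \<bar>normalized s \<omega>\<bar>)) / s"
    using integrable_normalized[of abs] by (simp add: prob_space)
  also have "\<dots> \<le> 8 / s"
    using s_pos expectation_abs_normalized by (intro divide_right_mono) auto
  finally show ?thesis .
qed

lemma expectation_of_bool_le:
  "expectation (\<lambda>\<omega>. of_bool (normalized s \<omega> \<le> x)) = cdf (distr M borel (normalized s)) x"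
proof -
  have "cdf (distr M borel (normalized s)) x = prob {\<omega> \<in> space M. normalized s \<omega> \<le> x}"
    by (simp add: cdf_def measure_distr vimage_def Int_def conj_commute)
  also have "\<dots> = expectation (indicator {\<omega> \<in> space M. normalized s \<omega> \<le> x})"
    by (simp add: Int_absorb2)
  also have "\<dots> = expectation (\<lambda>\<omega>. of_bool (normalized s \<omega> \<le> x))"
    by (intro Bochner_Integration.integral_cong) (auto simp: indicator_def)
  finally show ?thesis by simp
qed

text \<open>For the upper estimate the level is \<open>x + 1/s\<close> and for the lower one \<open>x - 1/s\<close>, so that the shifted
  indicator is the event \<open>W \<le> x\<close> both times. The error 8 comes from Stein's equation, and moving
  \<open>\<Phi>\<close> back to \<open>x\<close> costs one more \<open>1/s\<close>.\<close>

lemma berry_esseen: "\<bar>cdf (distr M borel (normalized s)) x - Phi x\<bar> \<le> 9 / s"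
proof -
  let ?F = "cdf (distr M borel (normalized s))"
  let ?w = "normalized s"
  define \<delta> where "\<delta> = 1 / s"
  have \<delta>: "0 \<le> \<delta>" using s_pos by (simp add: \<delta>_def)
  have ind: "(\<lambda>w. of_bool (w \<le> c) :: real) \<in> borel_measurable borel" for c :: real
    by measurable
  have int: "integrable M (\<lambda>\<omega>. ?w \<omega> * stein_sol z (?w \<omega>))"
    "integrable M (\<lambda>\<omega>. of_bool (?w \<omega> \<le> c) :: real)"
    "integrable M (\<lambda>\<omega>. (6 + 2 * \<bar>?w \<omega>\<bar>) * \<delta>)" for z c
    using integrable_normalized[of "\<lambda>w. w * stein_sol z w"] integrable_normalized[OF ind]
      integrable_normalized[of "\<lambda>w. (6 + 2 * \<bar>w\<bar>) * \<delta>"] by auto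
  have upper: "?F x \<le> Phi (x + \<delta>) + 8 * \<delta>"
  proof -
    let ?z = "x + \<delta>"
    \<comment> \<open>The comparison only bounds from above, so it is applied to the negated solution.\<close>
    have "expectation (\<lambda>\<omega>. ?w \<omega> * - stein_sol ?z (?w \<omega>))
        \<le> expectation (\<lambda>\<omega>. - (?w \<omega> * stein_sol ?z (?w \<omega>)) - of_bool (?w \<omega> \<le> ?z - \<delta>) + Phi ?z + (6 + 2 * \<bar>?w \<omega>\<bar>) * \<delta>)"
    proof (rule stein_comparison)
      fix a w :: real assume "w = a \<or> w = a + 1 / s"
      from stein_sol_step(2)[OF \<delta>, of w a ?z] this
      show "- stein_sol ?z (a + 1 / s) - - stein_sol ?z a \<le> 1 / s *
        (- (w * stein_sol ?z w) - of_bool (w \<le> ?z - \<delta>) + Phi ?z + (6 + 2 * \<bar>w\<bar>) * \<delta>)"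
        by (simp add: \<delta>_def algebra_simps)
    qed measurable
    then have "?F (?z - \<delta>) \<le> Phi ?z + expectation (\<lambda>\<omega>. (6 + 2 * \<bar>?w \<omega>\<bar>) * \<delta>)"
      using int by (simp add: expectation_of_bool_le prob_space del: of_bool_eq)
    then show ?thesis using stein_error_le by (simp add: \<delta>_def)
  qed
  have lower: "Phi (x - \<delta>) \<le> ?F x + 8 * \<delta>"
  proof -
    let ?z = "x - \<delta>"
    have "expectation (\<lambda>\<omega>. ?w \<omega> * stein_sol ?z (?w \<omega>))
        \<le> expectation (\<lambda>\<omega>. ?w \<omega> * stein_sol ?z (?w \<omega>) + of_bool (?w \<omega> \<le> ?z + \<delta>) - Phi ?z + (6 + 2 * \<bar>?w \<omega>\<bar>) * \<delta>)"
    proof (rule stein_comparison)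
      fix a w :: real assume "w = a \<or> w = a + 1 / s"
      from stein_sol_step(1)[OF \<delta>, of w a ?z] this
      show "stein_sol ?z (a + 1 / s) - stein_sol ?z a \<le> 1 / s *
        (w * stein_sol ?z w + of_bool (w \<le> ?z + \<delta>) - Phi ?z + (6 + 2 * \<bar>w\<bar>) * \<delta>)"
        by (simp add: \<delta>_def algebra_simps)
    qed measurable
    then have "Phi ?z \<le> ?F (?z + \<delta>) + expectation (\<lambda>\<omega>. (6 + 2 * \<bar>?w \<omega>\<bar>) * \<delta>)"
      using int by (simp add: expectation_of_bool_le prob_space del: of_bool_eq)
    then show ?thesis using stein_error_le by (simp add: \<delta>_def)
  qed
  have "Phi (x + \<delta>) \<le> Phi x + \<delta>" "Phi x \<le> Phi (x - \<delta>) + \<delta>"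
    using Phi_lipschitz[of x "x + \<delta>"] Phi_lipschitz[of "x - \<delta>" x] \<delta> by auto
  with upper lower have "\<bar>?F x - Phi x\<bar> \<le> 9 * \<delta>"
    by (simp add: abs_le_iff)
  then show ?thesis by (simp add: \<delta>_def)
qed

end

end

section \<open>Kolmogorov--Smirnov bounds for integer-valued sums and for noisy graphs\<close>

lemma ks_dist_le:
  assumes "\<And>x. \<bar>cdf N1 x - cdf N2 x\<bar> \<le> B"
  shows "ks_dist N1 N2 \<le> B"
  unfolding ks_dist_def by (rule cSUP_least) (use assms in auto)

lemma ks_dist_ge:
  assumes "real_distribution N1" "real_distribution N2"
  shows "\<bar>cdf N1 x - cdf N2 x\<bar> \<le> ks_dist N1 N2"
proof -
  interpret N1: real_distribution N1 by fact
  interpret N2: real_distribution N2 by fact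
  have "\<bar>cdf N1 x - cdf N2 x\<bar> \<le> 1" for x
    using N1.cdf_nonneg[of x] N1.cdf_bounded_prob[of x] N2.cdf_nonneg[of x] N2.cdf_bounded_prob[of x]
    by linarith
  then show ?thesis
    unfolding ks_dist_def by (intro cSUP_upper bdd_aboveI2[where M = 1]) auto
qed

text \<open>On \<open>[0, 1/2]\<close> the density is at least \<open>(1/3) (7/8)\<close>.\<close>

lemma Phi_increment_ge:
  assumes "0 \<le> t" "t \<le> 1 / 2"
  shows "t / 4 \<le> Phi t - Phi 0"
proof (cases "t = 0")
  case False
  then obtain u where u: "0 < u" "u < t" "Phi t - Phi 0 = t * std_normal_density u"
    using MVT2[of 0 t Phi std_normal_density] Phi_deriv assms by force
  have "u\<^sup>2 \<le> (1 / 2)\<^sup>2"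
    using u assms by (intro power_mono) auto
  then have "7 / 8 \<le> exp (- u\<^sup>2 / 2)"
    using exp_ge_add_one_self[of "- u\<^sup>2 / 2"] by (simp add: power2_eq_square)
  moreover have "1 / 3 \<le> 1 / sqrt (2 * pi)"
    using pi_less_4 by (intro divide_left_mono real_le_lsqrt) auto
  ultimately have "1 / 3 * (7 / 8) \<le> std_normal_density u"
    unfolding std_normal_density_def by (intro mult_mono) auto
  then have "1 / 4 \<le> std_normal_density u"
    by simp
  then have "t * (1 / 4) \<le> t * std_normal_density u"
    using assms by (intro mult_left_mono) auto
  then show ?thesis using u by simp
qed simp

context bernoulli_sum
begin

text \<open>An integral mean makes \<open>s W\<close> integer-valued, so \<open>W \<le> 0\<close> and \<open>W \<le> 1 / (2 s)\<close> are the same event. The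
  distribution function of \<open>W\<close> being constant there, one of the two endpoints carries at least half of the growth of \<open>\<Phi>\<close>.\<close>

lemma lattice_lower_bound:
  assumes s: "1 \<le> s" and mean: "mean \<in> \<int>"
  shows "1 / (16 * s) \<le> ks_dist (distr M borel (normalized s)) std_normal_distribution"
proof -
  let ?F = "cdf (distr M borel (normalized s))"
  have cdf_eq: "?F x = prob {\<omega> \<in> space M. normalized s \<omega> \<le> x}" for x
    by (simp add: cdf_def measure_distr vimage_def Int_def conj_commute)
  have "normalized s \<omega> \<le> 0 \<longleftrightarrow> normalized s \<omega> \<le> 1 / (2 * s)" for \<omega>
  proof -
    have "successes I \<omega> - mean \<in> \<int>"
      using mean by (simp add: successes_eq_card)
    then obtain j :: int where j: "successes I \<omega> - mean = of_int j"
      by (auto elim: Ints_cases)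
    have "normalized s \<omega> \<le> 1 / (2 * s) \<longleftrightarrow> real_of_int j \<le> 1 / 2"
      using s by (simp add: normalized_def j field_simps)
    also have "\<dots> \<longleftrightarrow> j \<le> 0"
      by linarith
    also have "\<dots> \<longleftrightarrow> normalized s \<omega> \<le> 0"
      using s by (simp add: normalized_def j divide_le_0_iff)
    finally show ?thesis by simp
  qed
  then have flat: "?F 0 = ?F (1 / (2 * s))"
    by (simp add: cdf_eq)
  have "1 / (2 * s) / 4 \<le> Phi (1 / (2 * s)) - Phi 0"
    using s by (intro Phi_increment_ge) (auto simp: field_simps)
  moreover have "\<bar>?F x - Phi x\<bar> \<le> ks_dist (distr M borel (normalized s)) std_normal_distribution" for x
    by (intro ks_dist_ge real_distribution_distr real_dist_normal_dist normalized_measurable)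
  from this[of 0] this[of "1 / (2 * s)"] flat
  have "Phi (1 / (2 * s)) - Phi 0 \<le> 2 * ks_dist (distr M borel (normalized s)) std_normal_distribution"
    by linarith
  ultimately show ?thesis by simp
qed

end

lemma prob_of_bernoulli_distr:
  assumes "Z \<in> measurable M (count_space UNIV)" "0 \<le> q" "q \<le> 1"
    and "distr M (count_space UNIV) Z = measure_pmf (bernoulli_pmf q)"
  shows "measure M {\<omega> \<in> space M. Z \<omega>} = q"
proof -
  have "measure M {\<omega> \<in> space M. Z \<omega>} = measure (distr M (count_space UNIV) Z) {True}"
    using assms(1) by (subst measure_distr) (auto intro!: arg_cong[where f = "measure M"])
  then show ?thesis
    using assms by (simp add: measure_pmf_single)
qed

text \<open>The two hypotheses on \<open>\<lambda>\<close> say that false positives and false negatives balance in the mean. Hence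
  the expected number of observed edges is the integer \<open>|E|\<close>, which both centres the discrepancy and
  makes the lattice bound applicable.\<close>

lemma edge_discrepancy_ks_bounds:
  fixes V :: "'a set" and E :: "'a set set" and M :: "'b measure" and Y :: "'a set \<Rightarrow> 'b \<Rightarrow> bool"
    and \<alpha> \<beta> lam :: real
  assumes V: "finite V" and E: "E \<subseteq> [V]\<^bsup>2\<^esup>"
    and \<alpha>: "0 < \<alpha>" "\<alpha> < 1" and \<beta>: "0 < \<beta>" "\<beta> < 1" and M: "prob_space M"
    and indep: "prob_space.indep_vars M (\<lambda>_. count_space UNIV) Y ([V]\<^bsup>2\<^esup>)"
    and non_edge: "\<And>e. e \<in> non_edges V E \<Longrightarrow>
           distr M (count_space UNIV) (Y e) = measure_pmf (bernoulli_pmf \<alpha>)"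
    and edge: "\<And>e. e \<in> E \<Longrightarrow>
           distr M (count_space UNIV) (Y e) = measure_pmf (bernoulli_pmf (1 - \<beta>))"
    and lam: "\<alpha> * real (card (non_edges V E)) = lam" "\<beta> * real (card E) = lam"
  defines "D \<equiv> edge_discrepancy V E Y"
  defines "s \<equiv> std_dev M D"
  defines "d \<equiv> ks_dist (distr M borel (\<lambda>\<omega>. D \<omega> / s)) std_normal_distribution"
  shows "s\<^sup>2 = lam * (2 - \<alpha> - \<beta>)" "0 \<le> s"
    and "1 \<le> s \<Longrightarrow> 1 / (16 * s) \<le> d" "1 \<le> s \<Longrightarrow> d \<le> 9 / s"
proof -
  interpret prob_space M by fact
  let ?I = "[V]\<^bsup>2\<^esup>"
  define p where "p e = (if e \<in> E then 1 - \<beta> else \<alpha>)" for e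
  have fin: "finite ?I" "finite E"
    using V E finite_imp_finite_nsets finite_subset by blast+
  interpret bernoulli_sum M ?I Y p
  proof
    fix e assume e: "e \<in> ?I"
    have "Y e \<in> measurable M (count_space UNIV)"
      using indep e unfolding indep_vars_def2 by auto
    then show "prob {\<omega> \<in> space M. Y e \<omega>} = p e"
      using \<alpha> \<beta> edge[of e] non_edge[of e] e
      by (intro prob_of_bernoulli_distr) (auto simp: p_def non_edges_def)
  qed (use fin indep in auto)
  have split: "(\<Sum>e\<in>?I. h e) = (\<Sum>e\<in>E. h e) + (\<Sum>e\<in>non_edges V E. h e)" for h :: "'a set \<Rightarrow> real"
    unfolding non_edges_def using fin E by (subst sum.subset_diff[OF E]) auto
  have mean: "mean = real (card E)"
    unfolding mean_def split using lam by (simp add: p_def non_edges_def algebra_simps)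
  have D_eq: "D \<omega> = successes ?I \<omega> - mean" for \<omega>
    by (simp add: D_def edge_discrepancy_def noisy_edges_def mean successes_eq_card)
  have var: "variance D = (\<Sum>e\<in>?I. bernoulli_var e)"
  proof -
    have "integrable M (successes ?I)"
      using integrable_successes[of ?I "\<lambda>x. x"] by simp
    then have "expectation D = 0"
      by (simp add: D_eq[abs_def] expectation_successes prob_space)
    then show ?thesis
      by (simp add: D_eq[abs_def] expectation_square)
  qed
  then have s2: "s\<^sup>2 = (\<Sum>e\<in>?I. bernoulli_var e)"
    unfolding s_def std_dev_def by (simp add: sum_nonneg bernoulli_var_nonneg)
  also have "\<dots> = card E * ((1 - \<beta>) * \<beta>) + card (non_edges V E) * (\<alpha> * (1 - \<alpha>))"
    unfolding split by (simp add: bernoulli_var_def p_def non_edges_def)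
  also have "\<dots> = (\<beta> * card E) * (1 - \<beta>) + (\<alpha> * card (non_edges V E)) * (1 - \<alpha>)"
    by (simp add: algebra_simps)
  also have "\<dots> = lam * (2 - \<alpha> - \<beta>)"
    unfolding lam by (simp add: algebra_simps)
  finally show "s\<^sup>2 = lam * (2 - \<alpha> - \<beta>)" .
  show "0 \<le> s"
    unfolding s_def std_dev_def by (simp add: variance_positive)
  have d_eq: "d = ks_dist (distr M borel (normalized s)) std_normal_distribution"
    unfolding d_def normalized_def[abs_def] D_eq ..
  show "1 / (16 * s) \<le> d" if "1 \<le> s"
    unfolding d_eq by (rule lattice_lower_bound[OF that]) (simp add: mean)
  show "d \<le> 9 / s" if "1 \<le> s"
    unfolding d_eq by (intro ks_dist_le berry_esseen s2) (use that in auto)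
qed

text \<open>Once \<open>s \<ge> 1\<close>, the bound \<open>1/s \<ge> 1/s\<^sup>2\<close> turns the rate \<open>1/s\<close> into the stated lower rate.\<close>

lemma asymp_between_of_variance:
  fixes r lam s d :: "nat \<Rightarrow> real"
  assumes r: "filterlim r at_top sequentially" and theta: "lam \<in> \<Theta>(r)"
    and var: "\<forall>\<^sub>F k in sequentially. lam k / 2 \<le> (s k)\<^sup>2 \<and> (s k)\<^sup>2 \<le> 2 * lam k"
    and s: "\<And>k. 0 \<le> s k"
    and d: "\<And>k. 1 \<le> s k \<Longrightarrow> 1 / (16 * s k) \<le> d k" "\<And>k. 1 \<le> s k \<Longrightarrow> d k \<le> 9 / s k"
  shows "asymp_between (\<lambda>k. r k powr - 1) d (\<lambda>k. r k powr (- 1 / 2))"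
proof -
  obtain c2 where c2: "0 < c2" "\<forall>\<^sub>F k in sequentially. norm (lam k) \<le> c2 * norm (r k)"
    using theta by (auto elim!: landau_o.bigE dest: bigthetaD1)
  obtain c1 where c1: "0 < c1" "\<forall>\<^sub>F k in sequentially. norm (lam k) \<ge> c1 * norm (r k)"
    using theta by (auto elim!: landau_omega.bigE dest: bigthetaD2)
  have large: "\<forall>\<^sub>F k in sequentially. max 1 (2 / c1) \<le> r k"
    using r unfolding filterlim_at_top by blast
  have "\<forall>\<^sub>F k in sequentially. 1 / (32 * c2) * r k powr - 1 \<le> d k \<and>
          d k \<le> 9 / sqrt (c1 / 2) * r k powr (- 1 / 2)"
    using c1(2) c2(2) var large
  proof eventually_elim
    case (elim k)
    have r_pos: "0 < r k" and "2 \<le> c1 * r k"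
      using elim(4) c1(1) by (auto simp: field_simps)
    have lam_nonneg: "0 \<le> lam k"
      using elim(3) zero_le_power2[of "s k"] by linarith
    have lower: "c1 * r k / 2 \<le> (s k)\<^sup>2" and upper: "(s k)\<^sup>2 \<le> 2 * (c2 * r k)"
      using elim r_pos lam_nonneg by auto
    then have "1 \<le> (s k)\<^sup>2"
      using \<open>2 \<le> c1 * r k\<close> by linarith
    then have s1: "1 \<le> s k"
      using s[of k] power_less_one_iff[of "s k" 2] by (meson not_le zero_less_numeral)
    have "s k * 1 \<le> s k * s k"
      using s1 by (intro mult_left_mono) auto
    then have "16 * s k \<le> 32 * c2 * r k"
      using upper by (simp add: power2_eq_square)
    then have "1 / (32 * c2 * r k) \<le> 1 / (16 * s k)"
      using s1 by (intro divide_left_mono) (auto intro!: mult_pos_pos c2 r_pos)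
    then have "1 / (32 * c2) * r k powr - 1 \<le> d k"
      using d(1)[OF s1] r_pos by (simp add: powr_minus_divide)
    moreover have "sqrt (c1 / 2 * r k) \<le> s k"
      using lower s[of k] by (intro real_le_lsqrt) auto
    then have "9 / s k \<le> 9 / (sqrt (c1 / 2) * sqrt (r k))"
      using c1(1) r_pos s1 by (intro divide_left_mono) (auto simp flip: real_sqrt_mult)
    then have "d k \<le> 9 / sqrt (c1 / 2) * r k powr (- 1 / 2)"
      using d(2)[OF s1] r_pos by (simp add: powr_minus_divide powr_half_sqrt)
    ultimately show ?case by simp
  qed
  moreover have "0 < 1 / (32 * c2)" "0 < 9 / sqrt (c1 / 2)"
    using c1(1) c2(1) by auto
  ultimately show ?thesis
    unfolding asymp_between_def by blast
qed

theorem theorem7: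
  fixes V :: "nat \<Rightarrow> 'a set" and E :: "nat \<Rightarrow> 'a set set"
    and M :: "nat \<Rightarrow> 'b measure" and Y :: "nat \<Rightarrow> 'a set \<Rightarrow> 'b \<Rightarrow> bool"
    and \<alpha> \<beta> lam :: "nat \<Rightarrow> real"
  assumes "\<And>k. finite (V k)" and "\<And>k. E k \<subseteq> [V k]\<^bsup>2\<^esup>"
    and "filterlim (\<lambda>k. card (V k)) at_top sequentially"
    and "\<And>k. 0 < \<alpha> k \<and> \<alpha> k < 1" and "\<And>k. 0 < \<beta> k \<and> \<beta> k < 1"
    and "\<And>k. prob_space (M k)"
    and "\<And>k. prob_space.indep_vars (M k) (\<lambda>_. count_space UNIV) (Y k) ([V k]\<^bsup>2\<^esup>)"
    and "\<And>k e. e \<in> non_edges (V k) (E k) \<Longrightarrow>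
           distr (M k) (count_space UNIV) (Y k e) = measure_pmf (bernoulli_pmf (\<alpha> k))"
    and "\<And>k e. e \<in> E k \<Longrightarrow>
           distr (M k) (count_space UNIV) (Y k e) = measure_pmf (bernoulli_pmf (1 - \<beta> k))"
    and "\<And>k. \<alpha> k * real (card (non_edges (V k) (E k))) = lam k"
    and "\<And>k. \<beta> k * real (card (E k)) = lam k"
    and "lam \<in> \<Theta>(\<lambda>k. 2 * real (card (E k)) / real (card (V k)))"
  defines "D \<equiv> \<lambda>k. edge_discrepancy (V k) (E k) (Y k)"
  defines "d \<equiv> \<lambda>k. ks_dist (distr (M k) borel (\<lambda>\<omega>. D k \<omega> / std_dev (M k) (D k)))
                            std_normal_distribution"
  shows "(sparse_graphs V E \<longrightarrow>
            asymp_between (\<lambda>k. ln (real (card (V k))) powr (- 1)) d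
                          (\<lambda>k. ln (real (card (V k))) powr (- 1 / 2))) \<and>
         (dense_graphs V E \<longrightarrow>
            asymp_between (\<lambda>k. real (card (V k)) powr (- 1)) d
                          (\<lambda>k. real (card (V k)) powr (- 1 / 2)))"
proof -
  let ?n = "\<lambda>k. real (card (V k))"
  let ?m = "\<lambda>k. real (card (E k))"
  define s where "s = (\<lambda>k. std_dev (M k) (D k))"
  have s_sq: "(s k)\<^sup>2 = lam k * (2 - \<alpha> k - \<beta> k)" and s_nonneg: "0 \<le> s k"
    and d_ge: "1 \<le> s k \<Longrightarrow> 1 / (16 * s k) \<le> d k" and d_le: "1 \<le> s k \<Longrightarrow> d k \<le> 9 / s k" for k
    using edge_discrepancy_ks_bounds[where V = "V k" and E = "E k" and M = "M k" and Y = "Y k"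
        and \<alpha> = "\<alpha> k" and \<beta> = "\<beta> k" and lam = "lam k"] assms(1-11)
    unfolding s_def D_def d_def by auto
  have n: "filterlim ?n at_top sequentially"
    using assms(3) filterlim_compose filterlim_real_sequentially by blast
  then have n_pos: "\<forall>\<^sub>F k in sequentially. 0 < ?n k"
    unfolding filterlim_at_top_dense by blast

  \<comment> \<open>Cancelling \<open>|E|\<close> in \<open>\<beta> |E| \<le> 2 c |E| / n\<close> gives \<open>\<beta> \<le> 1/2\<close> once \<open>n \<ge> 4 c\<close>,
    where \<open>c\<close> is the constant in \<open>\<lambda> = O(2 |E| / n)\<close>; a graph without edges has \<open>\<lambda> = 0\<close>.\<close>
  have var: "\<forall>\<^sub>F k in sequentially. lam k / 2 \<le> (s k)\<^sup>2 \<and> (s k)\<^sup>2 \<le> 2 * lam k"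
  proof -
    obtain c where c: "0 < c" "\<forall>\<^sub>F k in sequentially. norm (lam k) \<le> c * norm (2 * ?m k / ?n k)"
      using assms(12) by (auto elim!: landau_o.bigE dest: bigthetaD1)
    have "\<forall>\<^sub>F k in sequentially. 4 * c \<le> ?n k"
      using n unfolding filterlim_at_top by blast
    with c(2) n_pos show ?thesis
    proof eventually_elim
      case (elim k)
      have lam_nonneg: "0 \<le> lam k"
        using assms(5)[of k] assms(11)[of k] by (metis less_imp_le mult_nonneg_nonneg of_nat_0_le_iff)
      have "lam k * \<beta> k \<le> lam k * (1 / 2)"
      proof (cases "?m k = 0")
        case True
        then show ?thesis using assms(11)[of k] by simp
      next
        case False
        then have m: "0 < ?m k" by simp
        have "\<beta> k * ?m k \<le> c * (2 * ?m k / ?n k)"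
          using elim(1) assms(11)[of k] lam_nonneg by simp
        also have "\<dots> \<le> 1 / 2 * ?m k"
          using elim(2,3) m by (simp add: field_simps)
        finally have "\<beta> k \<le> 1 / 2"
          using m by simp
        then show ?thesis
          using lam_nonneg by (intro mult_left_mono)
      qed
      moreover have "lam k * \<alpha> k \<le> lam k * 1" "0 \<le> lam k * \<alpha> k" "0 \<le> lam k * \<beta> k"
        using lam_nonneg assms(4,5)[of k] by (auto intro!: mult_left_le mult_nonneg_nonneg)
      ultimately show ?case
        unfolding s_sq by (simp add: algebra_simps)
    qed
  qed

  have rate: "asymp_between (\<lambda>k. r k powr - 1) d (\<lambda>k. r k powr (- 1 / 2))"
    if r: "filterlim r at_top sequentially" and m: "?m \<in> \<Theta>(\<lambda>k. ?n k * r k)" for r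
  proof (rule asymp_between_of_variance[OF r _ var s_nonneg d_ge d_le])
    have "(\<lambda>k. 2 * ?m k / ?n k) \<in> \<Theta>(\<lambda>k. (?n k * r k) / ?n k)"
      using m n_pos by (intro landau_theta.divide) auto
    also have "(\<lambda>k. (?n k * r k) / ?n k) \<in> \<Theta>(r)"
      by (rule bigthetaI_cong) (use n_pos in eventually_elim, simp)
    finally show "lam \<in> \<Theta>(r)"
      using assms(12) landau_theta.trans by blast
  qed
  have "asymp_between (\<lambda>k. ln (?n k) powr - 1) d (\<lambda>k. ln (?n k) powr (- 1 / 2))"
    if "sparse_graphs V E"
    using that n by (intro rate) (auto simp: sparse_graphs_def intro: filterlim_compose[OF ln_at_top])
  moreover have "asymp_between (\<lambda>k. ?n k powr - 1) d (\<lambda>k. ?n k powr (- 1 / 2))"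
    if "dense_graphs V E"
    using that n by (intro rate) (auto simp: dense_graphs_def power2_eq_square)
  ultimately show ?thesis by blast
qed

end
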